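(* Let $A=\begin{bmatrix} a_{11} & a_{12} \\ a_{21} & a_{22} \end{bmatrix}$, $B=\begin{bmatrix} b_1 \\ b_2 \end{bmatrix}$, $K=[k_1\ k_2]$ with $A-BK$ Hurwitz. Let $\mathbf{x}_c=(x_{c,1},x_{c,2})\in\mathbb{R}^2$, $r>0$, $h(\mathbf{x})=\|\mathbf{x}-\mathbf{x}_c\|^2-r^2$, $\mathcal{C}=\{h\ge0\}$, and suppose $h(\mathbf{0}_2)>0$. Let $\beta=a_{11}b_2-b_1a_{21}$, $\gamma=a_{22}b_1-b_2a_{12}$, $T_3=-\gamma x_{c,2}+\beta x_{c,1}$. Let $\alpha_0>0$ and $\alpha(s)=\alpha_0s$, and suppose that, with $T_1=b_2\beta+b_1\gamma+\frac12\alpha_0(b_2^2+b_1^2)$ and $T_2=(\beta x_{c,1}-\gamma x_{c,2})^2+2\alpha_0r^2T_1$, one has $b_1^2+b_2^2>0$, $T_1>0$ and $$\frac{r}{\sqrt{b_2^2+b_1^2}}>\frac{|T_3|+\sqrt{T_2}}{2T_1}.$$ Define $\mathbf{x}_{*,+}=(\gamma z_+,\beta z_+)$ and $\mathbf{x}_{*,-}=(\gamma z_-,\beta z_-)$, where $$z_{\pm}=\frac{\gamma x_{c,1}+\beta x_{c,2}\pm\sqrt{r^2(\gamma^2+\beta^2)-T_3^2}}{\gamma^2+\beta^2}.$$ Then $\gamma x_{c,1}+\beta x_{c,2}\ne0$, and: (i) if $\gamma x_{c,1}+\beta x_{c,2}<0$, then $\hat{\mathcal{E}}=\{\mathbf{x}_{*,+}\}$,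 i.e. $\mathbf{x}_{*,+}$ is the only undesired equilibrium of the filtered system $\dot{\mathbf{x}}=(A-BK)\mathbf{x}+Bv(\mathbf{x})$; moreover $\mathbf{x}_{*,+}$ is a saddle point; (ii) if $\gamma x_{c,1}+\beta x_{c,2}>0$, then $\hat{\mathcal{E}}=\{\mathbf{x}_{*,-}\}$, i.e. $\mathbf{x}_{*,-}$ is the only undesired equilibrium of the filtered system; moreover $\mathbf{x}_{*,-}$ is a saddle point.
   Context: The nominal controller for $\dot{\mathbf{x}}=A\mathbf{x}+B\mathbf{u}$ is $\mathbf{u}=-K\mathbf{x}$. With $\eta(\mathbf{x})=\nabla h(\mathbf{x})^\top(A-BK)\mathbf{x}+\alpha(h(\mathbf{x}))$, the safety filter is $v(\mathbf{x})=0$ if $\eta(\mathbf{x})\ge0$ and $v(\mathbf{x})=-\dfrac{\eta(\mathbf{x})G(\mathbf{x})^{-1}B^\top\nabla h(\mathbf{x})}{\nabla h(\mathbf{x})^\top BG(\mathbf{x})^{-1}B^\top\nabla h(\mathbf{x})}$ if $\eta(\mathbf{x})<0$, where $G:\mathbb{R}^2\to\mathbb{R}_{>0}$ is continuously differentiable (since $G$ is scalar here, $v$ does not depend on it). The hypotheses guarantee that $h$ is a strict CBF, i.e. for each $\mathbf{x}\in\mathcal{C}$ there is $u$ with $\nabla h(\mathbf{x})^\top(A\mathbf{x}+Bu)+\alpha(h(\mathbf{x}))>0$, so $v$ is well defined on $\mathcal{C}$. The set of undesired equilibria is $\hat{\mathcal{E}}=\{\mathbf{x}:\ h(\mathbf{x})=0,\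 \exists\,\delta<0 \text{ with } (A-BK)\mathbf{x}=\delta BG(\mathbf{x})^{-1}B^\top\nabla h(\mathbf{x})\}$; equivalently, the equilibria of the filtered system in $\mathcal{C}$ other than the origin. A saddle point is an equilibrium at which the Jacobian of the closed-loop vector field has one positive and one negative eigenvalue. *)

theory Defs
  imports "HOL-Analysis.Analysis"
begin

definition grad :: "('a::euclidean_space \<Rightarrow> real) \<Rightarrow> 'a \<Rightarrow> 'a" where
  "grad f x = (THE D. GDERIV f x :> D)"

definition continuously_differentiable :: "('a::euclidean_space \<Rightarrow> real) \<Rightarrow> bool" where
  "continuously_differentiable f \<longleftrightarrow> (\<forall>x. f differentiable (at x)) \<and> continuous_on UNIV (grad f)"

definition is_eigenvalue :: "'a::field^'n^'n \<Rightarrow> 'a \<Rightarrow> bool" where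
  "is_eigenvalue M l \<longleftrightarrow> (\<exists>w. w \<noteq> 0 \<and> M *v w = l *s w)"

definition Hurwitz :: "real^'n^'n \<Rightarrow> bool" where
  "Hurwitz M \<longleftrightarrow> (\<forall>l. is_eigenvalue (map_matrix complex_of_real M) l \<longrightarrow> Re l < 0)"

(* The control is scalar: the input matrix B (one column) and the gain K (one row) are given
   as vectors; the middle index type of the product is the one-element type 1. *)
definition nominal_matrix :: "real^'n^'n \<Rightarrow> real^'n \<Rightarrow> real^'n \<Rightarrow> real^'n^'n" where
  "nominal_matrix A B K = A - (columnvector B :: real^1^'n) ** (rowvector K :: real^'n^1)"

definition safe_set :: "(real^'n \<Rightarrow> real) \<Rightarrow> (real^'n) set" where
  "safe_set h = {x. h x \<ge> 0}"

definition safety_margin ::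
  "real^'n^'n \<Rightarrow> real^'n \<Rightarrow> real^'n \<Rightarrow> (real \<Rightarrow> real) \<Rightarrow> (real^'n \<Rightarrow> real) \<Rightarrow> real^'n \<Rightarrow> real" where
  "safety_margin A B K \<alpha> h x = grad h x \<bullet> (nominal_matrix A B K *v x) + \<alpha> (h x)"

(* Where the denominator vanishes (possible only outside the safe set when h is a strict
   control barrier function), the total division of HOL makes the filter 0. *)
definition safety_filter ::
  "real^'n^'n \<Rightarrow> real^'n \<Rightarrow> real^'n \<Rightarrow> (real^'n \<Rightarrow> real) \<Rightarrow> (real \<Rightarrow> real) \<Rightarrow> (real^'n \<Rightarrow> real)
    \<Rightarrow> real^'n \<Rightarrow> real" where
  "safety_filter A B K G \<alpha> h x =
    (if safety_margin A B K \<alpha> h x \<ge> 0 then 0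
     else - ((safety_margin A B K \<alpha> h x * inverse (G x) * (B \<bullet> grad h x))
             / ((grad h x \<bullet> B) * inverse (G x) * (B \<bullet> grad h x))))"

definition filtered_system ::
  "real^'n^'n \<Rightarrow> real^'n \<Rightarrow> real^'n \<Rightarrow> (real^'n \<Rightarrow> real) \<Rightarrow> (real \<Rightarrow> real) \<Rightarrow> (real^'n \<Rightarrow> real)
    \<Rightarrow> real^'n \<Rightarrow> real^'n" where
  "filtered_system A B K G \<alpha> h x =
    nominal_matrix A B K *v x + safety_filter A B K G \<alpha> h x *\<^sub>R B"

definition undesired_equilibria ::
  "real^'n^'n \<Rightarrow> real^'n \<Rightarrow> real^'n \<Rightarrow> (real^'n \<Rightarrow> real) \<Rightarrow> (real^'n \<Rightarrow> real) \<Rightarrow> (real^'n) set" where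
  "undesired_equilibria A B K G h =
    {x. h x = 0 \<and>
        (\<exists>\<delta><0. nominal_matrix A B K *v x = (\<delta> * inverse (G x) * (B \<bullet> grad h x)) *\<^sub>R B)}"

definition equilibrium :: "('a::real_vector \<Rightarrow> 'a) \<Rightarrow> 'a \<Rightarrow> bool" where
  "equilibrium F x \<longleftrightarrow> F x = 0"

(* Differentiability is required explicitly: jacobian is unspecified at points where F is not
   differentiable. In the plane there are at most two eigenvalues, so the condition says that the
   eigenvalues are exactly one positive and one negative number. *)
definition saddle_point :: "(real^2 \<Rightarrow> real^2) \<Rightarrow> real^2 \<Rightarrow> bool" where
  "saddle_point F x \<longleftrightarrow>
    equilibrium F x \<and> F differentiable (at x) \<and>
    (\<exists>l m. l > 0 \<and> m < 0 \<and>
       is_eigenvalue (jacobian F (at x)) l \<and> is_eigenvalue (jacobian F (at x)) m)"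

end

theory Submission
  imports Defs
begin

text \<open>Let \<open>M = A - BK\<close> and \<open>p = (\<gamma>, \<beta>) = adj(M) B\<close>, so that \<open>M p = det(M) B\<close> with \<open>det M > 0\<close> by the
  Hurwitz property. The vectors that \<open>M\<close> maps into the span of \<open>B\<close> are the multiples \<open>z p\<close>, and
  \<open>z p\<close> is an undesired equilibrium iff it lies on the circle and \<open>z (B \<bullet> (z p - x\<^sub>c)) < 0\<close>. Both
  intersections of the line with the circle have \<open>z\<close> of the sign of \<open>p \<bullet> x\<^sub>c\<close>, because the origin is
  outside the disc. The strict barrier condition amounts to \<open>r (p \<bullet> B) > \<bar>B\<bar> \<bar>T3\<bar>\<close>, which makes the
  sign of \<open>B \<bullet> (z p - x\<^sub>c)\<close> the sign in front of the square root. Hence exactly one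
  intersection qualifies.

  Near that point \<open>x\<close>, with \<open>n = x - x\<^sub>c\<close>, the closed loop satisfies \<open>\<nabla>h \<bullet> F = - \<alpha>0 h\<close> (the filter is
  active) and, everywhere, \<open>F y \<bullet> perp B = y \<bullet> perp p\<close> (the control acts along \<open>B\<close>).
  Differentiating, \<open>n\<close> is a left eigenvector of the Jacobian for \<open>- \<alpha>0\<close>, and the tangent
  \<open>perp n\<close> is a right eigenvector for \<open>(p \<bullet> n) / (B \<bullet> n) > 0\<close>.\<close>

section \<open>Gradient of the squared-distance barrier\<close>

text \<open>\<open>grad\<close> is a definite description, so uniqueness of the derivative is what
  gives it a value.\<close>

lemma grad_eqI:
  assumes "GDERIV f x :> D"
  shows "grad f x = D"
proof -
  have "E = D" if "GDERIV f x :> E" for E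
  proof -
    have "(\<lambda>v. v \<bullet> E) = (\<lambda>v. v \<bullet> D)"
      using has_derivative_unique[OF that[unfolded gderiv_def] assms[unfolded gderiv_def]] .
    then have "\<forall>v. v \<bullet> E = v \<bullet> D" by metis
    then show ?thesis by (rule iffD1[OF vector_eq_ldot])
  qed
  with assms show ?thesis
    unfolding grad_def by (intro the_equality)
qed

lemma GDERIV_norm_diff_sq:
  "GDERIV (\<lambda>x. (norm (x - c))\<^sup>2 - s) x :> 2 *\<^sub>R (x - c)"
  unfolding gderiv_def power2_norm_eq_inner
  by (auto intro!: derivative_eq_intros simp: inner_commute algebra_simps)

section \<open>Real eigenvalues and the Hurwitz property\<close>

text \<open>An eigenvector is a nonzero kernel vector of \<open>M - mat l\<close>. The determinant
  form serves both for transposes and for the characteristic equation in the plane.\<close>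

lemma eigenvalue_iff_det:
  fixes M :: "'a::field^'n^'n"
  shows "is_eigenvalue M l \<longleftrightarrow> det (M - mat l) = 0"
proof -
  have "mat l *v w = l *s w" for w :: "'a^'n"
    by (simp add: vec_eq_iff matrix_vector_mult_def mat_def if_distrib if_distribR cong: if_cong)
  then have "(M - mat l) *v w = M *v w - l *s w" for w
    by (simp add: matrix_vector_mult_diff_rdistrib)
  then show ?thesis
    unfolding is_eigenvalue_def
    using invertible_det_nz[of "M - mat l"] invertible_left_inverse[of "M - mat l"]
      matrix_left_invertible_ker[of "M - mat l"]
    by auto
qed

lemma eigenvalue_transpose:
  fixes M :: "'a::field^'n^'n"
  shows "is_eigenvalue (transpose M) l \<longleftrightarrow> is_eigenvalue M l"
proof -
  have "transpose M - mat l = transpose (M - mat l)"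
    by (simp add: vec_eq_iff transpose_def mat_def)
  then show ?thesis by (simp add: eigenvalue_iff_det)
qed

text \<open>\<open>Hurwitz\<close> speaks of complex eigenvalues; a real eigenvector, embedded
  entrywise, is a complex one for the same number.\<close>

lemma Hurwitz_real_eigenvalue_neg:
  assumes "Hurwitz M" and "is_eigenvalue M l"
  shows "l < 0"
proof -
  obtain w where w: "w \<noteq> 0" "M *v w = l *s w"
    using assms(2) unfolding is_eigenvalue_def by blast
  let ?w = "\<chi> i. complex_of_real (w $ i)"
  have "?w \<noteq> 0" using w(1) by (simp add: vec_eq_iff)
  moreover have "map_matrix complex_of_real M *v ?w = complex_of_real l *s ?w"
  proof -
    have "(\<Sum>j\<in>UNIV. complex_of_real (M $ i $ j) * complex_of_real (w $ j)) =
        complex_of_real l * complex_of_real (w $ i)" for i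
    proof -
      have "(M *v w) $ i = l * w $ i" by (simp add: w(2))
      then show ?thesis
        by (metis (mono_tags, lifting) matrix_vector_mult_def of_real_mult of_real_sum sum.cong vec_lambda_beta)
    qed
    then show ?thesis
      by (simp add: vec_eq_iff matrix_vector_mult_def map_matrix_def)
  qed
  ultimately have "is_eigenvalue (map_matrix complex_of_real M) (complex_of_real l)"
    unfolding is_eigenvalue_def by blast
  with assms(1) show ?thesis unfolding Hurwitz_def by fastforce
qed

text \<open>Otherwise the discriminant would be at least the square of the trace, and the larger
  root of the characteristic polynomial would be real and nonnegative.\<close>

lemma Hurwitz_2_det_pos:
  fixes M :: "real^2^2"
  assumes "Hurwitz M"
  shows "det M > 0"
proof (rule ccontr)
  assume "\<not> det M > 0"
  define t where "t = M$1$1 + M$2$2"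
  define s where "s = sqrt (t\<^sup>2 - 4 * det M)"
  have le: "t\<^sup>2 \<le> t\<^sup>2 - 4 * det M" using \<open>\<not> det M > 0\<close> by simp
  then have s2: "s\<^sup>2 = t\<^sup>2 - 4 * det M"
    unfolding s_def by (meson order.trans real_sqrt_pow2 zero_le_power2)
  have "\<bar>t\<bar> \<le> s" unfolding s_def using le by (metis real_sqrt_abs real_sqrt_le_iff)
  have "det (M - mat m) = m\<^sup>2 - t * m + det M" for m
    by (simp add: det_2 mat_def t_def power2_eq_square algebra_simps)
  then have "det (M - mat ((t + s) / 2)) = ((t + s) / 2)\<^sup>2 - t * ((t + s) / 2) + det M" .
  also have "\<dots> = 0" using s2 by (simp add: power2_eq_square field_simps)
  finally have "(t + s) / 2 < 0"
    using Hurwitz_real_eigenvalue_neg[OF assms] eigenvalue_iff_det by blast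
  with \<open>\<bar>t\<bar> \<le> s\<close> show False by simp
qed

section \<open>The closed loop where the filter is active\<close>

text \<open>The positive scalar weight cancels from the filter; for \<open>y = 0\<close> both sides
  are 0 by total division.\<close>

lemma filter_quotient_cancel:
  fixes g :: real
  assumes "g > 0"
  shows "e * inverse g * y / (y * inverse g * y) = e / y"
  using assms by (cases "y = 0") (simp_all add: field_simps)

context
  fixes A :: "real^'n^'n" and B K :: "real^'n" and G h :: "real^'n \<Rightarrow> real" and \<alpha> :: "real \<Rightarrow> real"
  assumes G_pos: "\<And>x. G x > 0"
begin

lemma filtered_system_active:
  assumes "safety_margin A B K \<alpha> h x < 0"
  shows "filtered_system A B K G \<alpha> h x =
    nominal_matrix A B K *v x - (safety_margin A B K \<alpha> h x / (B \<bullet> grad h x)) *\<^sub>R B"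
  using assms filter_quotient_cancel[OF G_pos]
  by (simp add: filtered_system_def safety_filter_def inner_commute)

text \<open>An active filter cancels the whole margin, so the barrier inequality holds with
  equality. This places equilibria on the boundary and later yields one eigenvalue of the
  Jacobian.\<close>

lemma inner_grad_filtered_system_active:
  assumes "safety_margin A B K \<alpha> h x < 0" and "B \<bullet> grad h x \<noteq> 0"
  shows "grad h x \<bullet> filtered_system A B K G \<alpha> h x = - \<alpha> (h x)"
  using assms
  by (simp add: filtered_system_active inner_diff_right inner_commute[of _ B])
    (simp add: safety_margin_def)

text \<open>The drift is a multiple of \<open>B\<close> here, which turns the margin into the
  negative number \<open>\<delta> * inverse (G x) * (B \<bullet> grad h x)\<^sup>2\<close>; the
  correction is then minus the drift.\<close>

lemma undesired_equilibrium_active: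
  assumes "x \<in> undesired_equilibria A B K G h" and "nominal_matrix A B K *v x \<noteq> 0" and "\<alpha> 0 = 0"
  shows "B \<bullet> grad h x \<noteq> 0" and "safety_margin A B K \<alpha> h x < 0"
    and "filtered_system A B K G \<alpha> h x = 0"
proof -
  let ?y = "B \<bullet> grad h x"
  obtain \<delta> where x: "h x = 0" "\<delta> < 0"
    "nominal_matrix A B K *v x = (\<delta> * inverse (G x) * ?y) *\<^sub>R B"
    using assms(1) unfolding undesired_equilibria_def by blast
  show y: "?y \<noteq> 0" using x(3) assms(2) by auto
  have \<eta>: "safety_margin A B K \<alpha> h x = \<delta> * inverse (G x) * ?y\<^sup>2"
    using x assms(3) by (simp add: safety_margin_def inner_commute power2_eq_square)
  show neg: "safety_margin A B K \<alpha> h x < 0"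
    unfolding \<eta> using x(2) y G_pos[of x] by (simp add: mult_less_0_iff)
  show "filtered_system A B K G \<alpha> h x = 0"
    unfolding filtered_system_active[OF neg] \<eta> x(3) using y by (simp add: power2_eq_square)
qed

text \<open>Away from the origin the drift is nonzero by injectivity, so an equilibrium needs an
  active filter; the barrier equality then forces \<open>\<alpha> (h x) = 0\<close>.\<close>

lemma safe_equilibria_eq:
  assumes inj: "\<And>x. nominal_matrix A B K *v x = 0 \<Longrightarrow> x = 0"
    and \<alpha>: "\<And>s. \<alpha> s = 0 \<longleftrightarrow> s = 0" and "h 0 > 0"
  shows "{x \<in> safe_set h. equilibrium (filtered_system A B K G \<alpha> h) x \<and> x \<noteq> 0} =
    undesired_equilibria A B K G h"
proof (intro equalityI subsetI)
  fix x
  assume "x \<in> {x \<in> safe_set h. equilibrium (filtered_system A B K G \<alpha> h) x \<and> x \<noteq> 0}"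
  then have eq: "filtered_system A B K G \<alpha> h x = 0" and "x \<noteq> 0"
    by (auto simp: equilibrium_def)
  then have Mx: "nominal_matrix A B K *v x \<noteq> 0" using inj by blast
  let ?y = "B \<bullet> grad h x" and ?\<eta> = "safety_margin A B K \<alpha> h x"
  have neg: "?\<eta> < 0"
    using eq Mx by (auto simp: filtered_system_def safety_filter_def split: if_splits)
  \<comment> \<open>With \<open>?y = 0\<close> the quotient would be 0 and the nonzero drift would
    stay uncompensated.\<close>
  have y: "?y \<noteq> 0" using eq Mx filtered_system_active[OF neg] by auto
  have "h x = 0" using inner_grad_filtered_system_active[OF neg y] eq \<alpha> by simp
  \<comment> \<open>This number is the \<delta> to be exhibited, read off from
    \<open>nominal_matrix A B K *v x = (?\<eta> / ?y) *\<^sub>R B\<close>.\<close>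
  moreover have "?\<eta> * G x / ?y\<^sup>2 < 0"
    using neg y G_pos[of x] by (simp add: divide_neg_pos mult_neg_pos)
  moreover have "nominal_matrix A B K *v x = ((?\<eta> * G x / ?y\<^sup>2) * inverse (G x) * ?y) *\<^sub>R B"
    using eq filtered_system_active[OF neg] y G_pos[of x]
    by (simp add: power2_eq_square field_simps)
  ultimately show "x \<in> undesired_equilibria A B K G h"
    unfolding undesired_equilibria_def by blast
next
  fix x assume x: "x \<in> undesired_equilibria A B K G h"
  then have "h x = 0" by (simp add: undesired_equilibria_def)
  moreover from this have "x \<noteq> 0" using assms(3) by auto
  ultimately show "x \<in> {x \<in> safe_set h. equilibrium (filtered_system A B K G \<alpha> h) x \<and> x \<noteq> 0}"
    using undesired_equilibrium_active(3)[OF x] inj \<alpha> by (auto simp: safe_set_def equilibrium_def)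
qed

end

section \<open>Plane geometry and a criterion for saddle points\<close>

text \<open>The clockwise quarter turn, so that \<open>u \<bullet> perp v\<close> is the determinant
  with columns \<open>u\<close> and \<open>v\<close>.\<close>

definition perp :: "real^2 \<Rightarrow> real^2" where
  "perp v = vector [v $ 2, - v $ 1]"

lemma inner_2: "u \<bullet> v = u $ 1 * v $ 1 + u $ 2 * v $ 2" for u v :: "real^2"
  by (simp add: inner_vec_def sum_2)

lemma inner_perp: "u \<bullet> perp v = u $ 1 * v $ 2 - u $ 2 * v $ 1"
  by (simp add: perp_def inner_2)

lemma inner_perp_self [simp]: "v \<bullet> perp v = 0"
  by (simp add: inner_perp)

lemma perp_inner_perp [simp]: "perp u \<bullet> perp v = u \<bullet> v"
  by (simp add: perp_def inner_2)

text \<open>Expansion of \<open>u \<bullet> w\<close> in the orthogonal frame \<open>v\<close>,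
  \<open>perp v\<close>, cleared of denominators; \<open>u = w\<close> gives Lagrange's
  identity.\<close>

lemma inner_perp_mult:
  "(u \<bullet> perp v) * (w \<bullet> perp v) + (u \<bullet> v) * (w \<bullet> v) = (u \<bullet> w) * (v \<bullet> v)"
  by (simp add: perp_def inner_2 algebra_simps)

lemma parallel_if_inner_perp_zero:
  assumes "u \<bullet> perp v = 0" and "v \<noteq> 0"
  shows "u = ((u \<bullet> v) / (v \<bullet> v)) *\<^sub>R v"
proof -
  have "(v \<bullet> v) * u $ 1 = (u \<bullet> v) * v $ 1" "(v \<bullet> v) * u $ 2 = (u \<bullet> v) * v $ 2"
    using assms(1)[unfolded inner_perp] unfolding inner_2 by algebra+
  moreover have "v \<bullet> v \<noteq> 0" using assms(2) by simp
  ultimately show ?thesis by (simp add: vec_eq_iff forall_2 field_simps)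
qed

text \<open>A left eigenvector \<open>n\<close> gives the eigenvalue \<open>- a\<close> by
  transposition. The Jacobian then preserves the line orthogonal to \<open>n\<close>, and testing
  against \<open>perp b\<close> reads off the factor there.\<close>

lemma saddle_pointI:
  fixes b n p :: "real^2"
  assumes F: "F x = 0" "F differentiable (at x)" and "a > 0"
    and n: "\<And>w. n \<bullet> (jacobian F (at x) *v w) = - a * (n \<bullet> w)"
    and b: "\<And>w. (jacobian F (at x) *v w) \<bullet> perp b = w \<bullet> perp p"
    and pos: "(b \<bullet> n) * (p \<bullet> n) > 0"
  shows "saddle_point F x"
proof -
  let ?J = "jacobian F (at x)" and ?l = "(p \<bullet> n) / (b \<bullet> n)"
  have nz: "n \<noteq> 0" "b \<bullet> n \<noteq> 0" using pos by auto
  have "transpose ?J *v n = - a *s n"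
  proof -
    have "(transpose ?J *v n) \<bullet> w = (- a *s n) \<bullet> w" for w
      using n[of w] by (simp add: dot_lmul_matrix scalar_mult_eq_scaleR flip: vector_transpose_matrix)
    then show ?thesis using vector_eq_rdot by blast
  qed
  then have neg: "is_eigenvalue ?J (- a)"
    using nz(1) eigenvalue_transpose unfolding is_eigenvalue_def by metis
  \<comment> \<open>The residual \<open>?e\<close> is orthogonal to \<open>n\<close> and to
    \<open>perp b\<close>, which are independent because
    \<open>b \<bullet> n \<noteq> 0\<close>.\<close>
  let ?e = "?J *v perp n - ?l *\<^sub>R perp n"
  have "n \<bullet> ?e = 0" using n[of "perp n"] by (simp add: inner_diff_right)
  moreover have "?e \<bullet> perp b = 0"
    using b[of "perp n"] nz(2)
    by (simp add: inner_diff_left inner_commute[of n b] inner_commute[of n p])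
  ultimately have "(b \<bullet> n) * ?e $ 1 = 0" "(b \<bullet> n) * ?e $ 2 = 0"
    unfolding inner_perp inner_2[of n] inner_2[of b] by algebra+
  then have "?e = 0" using nz(2) by (simp add: vec_eq_iff forall_2)
  moreover have "perp n \<noteq> 0" using nz(1) by (auto simp: perp_def vec_eq_iff forall_2)
  ultimately have "is_eigenvalue ?J ?l"
    unfolding is_eigenvalue_def scalar_mult_eq_scaleR by auto
  moreover have "?l > 0" using pos by (auto simp: zero_less_divide_iff zero_less_mult_iff)
  ultimately show ?thesis
    unfolding saddle_point_def equilibrium_def using F neg \<open>a > 0\<close> by force
qed

section \<open>Intersections of a line through the origin with the circle\<close>

text \<open>With \<open>u = (p \<bullet> p) * z - p \<bullet> c\<close> the circle reads
  \<open>u\<^sup>2 = D\<close>. By \<open>outside\<close>, \<open>z\<close> has the sign of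
  \<open>p \<bullet> c\<close>; by \<open>key\<close>,
  \<open>b \<bullet> (z *\<^sub>R p - c)\<close> has the sign of \<open>u\<close>. The product is
  negative exactly when \<open>u\<close> has the sign \<sigma> opposite to
  \<open>p \<bullet> c\<close>.\<close>

lemma circle_line_root:
  fixes b c p :: "real^2" and r \<sigma> z :: real
  defines "D \<equiv> r\<^sup>2 * (p \<bullet> p) - (c \<bullet> perp p)\<^sup>2"
  assumes outside: "c \<bullet> c > r\<^sup>2" and pb: "p \<bullet> b > 0"
    and key: "(c \<bullet> perp p)\<^sup>2 * (b \<bullet> b) < (r * (p \<bullet> b))\<^sup>2"
  shows "p \<bullet> c \<noteq> 0"
    and "\<sigma>\<^sup>2 = 1 \<Longrightarrow> \<sigma> * (p \<bullet> c) < 0 \<Longrightarrow>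
      norm (z *\<^sub>R p - c) ^ 2 = r\<^sup>2 \<and> z * (b \<bullet> (z *\<^sub>R p - c)) < 0 \<longleftrightarrow>
      z = (p \<bullet> c + \<sigma> * sqrt D) / (p \<bullet> p)"
    and "norm (z *\<^sub>R p - c) ^ 2 = r\<^sup>2 \<Longrightarrow> (b \<bullet> (z *\<^sub>R p - c)) * (p \<bullet> (z *\<^sub>R p - c)) > 0"
proof -
  \<comment> \<open>Up to scaling, \<open>S\<close>, \<open>T\<close> are the coordinates of
    \<open>c\<close> and \<open>Q\<close>, \<open>W\<close> those of \<open>b\<close> in the frame
    \<open>p\<close>, \<open>perp p\<close>.\<close>
  define P S T Q W where "P = p \<bullet> p" and "S = p \<bullet> c" and "T = c \<bullet> perp p"
    and "Q = p \<bullet> b" and "W = b \<bullet> perp p"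
  have P: "P > 0" using pb by (auto simp: P_def)
  have lag: "S\<^sup>2 + T\<^sup>2 = P * (c \<bullet> c)" "Q\<^sup>2 + W\<^sup>2 = P * (b \<bullet> b)" "P * (b \<bullet> c) = Q * S + T * W"
    using inner_perp_mult[of c p c] inner_perp_mult[of b p b] inner_perp_mult[of b p c]
    unfolding P_def S_def T_def Q_def W_def by (simp_all add: power2_eq_square inner_commute mult.commute)
  have D: "D = r\<^sup>2 * P - T\<^sup>2" by (simp add: D_def P_def T_def)
  \<comment> \<open>Lagrange's identity for \<open>b\<close> turns \<open>key\<close> into a bound
    on \<open>T * W\<close>, which also forces \<open>D > 0\<close>.\<close>
  have "D * Q\<^sup>2 - (T * W)\<^sup>2 = P * ((r * Q)\<^sup>2 - T\<^sup>2 * (b \<bullet> b))"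
    using lag(2) unfolding D power2_eq_square by algebra
  then have DQ: "(T * W)\<^sup>2 < D * Q\<^sup>2"
    using key P unfolding Q_def[symmetric] T_def[symmetric]
    by (metis diff_gt_0_iff_gt mult_pos_pos)
  have Q: "Q > 0" using pb by (simp add: Q_def)
  have Dpos: "D > 0"
    using DQ Q by (smt (verit) mult_nonneg_nonneg zero_le_power2 mult_nonpos_nonneg)
  have sD: "(sqrt D)\<^sup>2 = D" "sqrt D > 0" using Dpos by simp_all
  have TW: "\<bar>T * W\<bar> < sqrt D * Q"
    using DQ Q sD by (metis abs_of_pos power_mult_distrib mult_pos_pos real_sqrt_abs real_sqrt_less_iff)
  have "S\<^sup>2 = D + P * (c \<bullet> c - r\<^sup>2)" using lag(1) unfolding D by (simp add: algebra_simps)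
  then have "S\<^sup>2 > D" using outside P by simp
  then have sDS: "sqrt D < \<bar>S\<bar>" by (metis real_sqrt_abs real_sqrt_less_iff)
  then show "p \<bullet> c \<noteq> 0" using sD by (auto simp: S_def)
  have circ: "norm (z *\<^sub>R p - c) ^ 2 = r\<^sup>2 \<longleftrightarrow> (P * z - S)\<^sup>2 = D" for z
  proof -
    have "P * (norm (z *\<^sub>R p - c) ^ 2 - r\<^sup>2) = (P * z - S)\<^sup>2 - D"
      using lag(1) unfolding D power2_norm_eq_inner inner_diff_left inner_diff_right P_def S_def
      by (simp add: inner_commute[of c p] power2_eq_square algebra_simps)
    then show ?thesis using P by (smt (verit) mult_eq_0_iff)
  qed
  \<comment> \<open>The term \<open>T * W\<close> is smaller in modulus than
    \<open>Q * sqrt D\<close>, so on the circle it cannot change the sign of the right-hand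
    side.\<close>
  have bn: "P * (b \<bullet> (z *\<^sub>R p - c)) = Q * (P * z - S) - T * W" for z
    using lag(3) by (simp add: inner_diff_right Q_def inner_commute[of b p] algebra_simps)
  have pn: "p \<bullet> (z *\<^sub>R p - c) = P * z - S" for z
    by (simp add: inner_diff_right P_def S_def)
  have sgn: "(b \<bullet> (z *\<^sub>R p - c)) * (P * z - S) > 0"
    if "(P * z - S)\<^sup>2 = D" for z
  proof -
    let ?u = "P * z - S"
    have "\<bar>?u\<bar> = sqrt D" using that by (metis real_sqrt_abs)
    then have "?u = sqrt D \<or> ?u = - sqrt D" by linarith
    then have "(Q * ?u - T * W) * ?u > 0"
    proof
      assume u: "?u = sqrt D"
      have "Q * ?u - T * W > 0" using TW unfolding u by (simp add: abs_less_iff mult.commute)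
      with sD(2) u show ?thesis by simp
    next
      assume u: "?u = - sqrt D"
      have "Q * ?u - T * W < 0" using TW unfolding u by (simp add: abs_less_iff mult.commute)
      moreover have "?u < 0" using sD(2) u by simp
      ultimately show ?thesis by (rule mult_neg_neg)
    qed
    then have "P * ((b \<bullet> (z *\<^sub>R p - c)) * ?u) > 0" using bn[of z] by (metis mult.assoc)
    then show "(b \<bullet> (z *\<^sub>R p - c)) * ?u > 0" using P by (simp add: zero_less_mult_iff)
  qed
  show "norm (z *\<^sub>R p - c) ^ 2 = r\<^sup>2 \<Longrightarrow> (b \<bullet> (z *\<^sub>R p - c)) * (p \<bullet> (z *\<^sub>R p - c)) > 0"
    unfolding circ pn by (rule sgn)
  assume \<sigma>: "\<sigma>\<^sup>2 = 1" "\<sigma> * (p \<bullet> c) < 0"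
  have sig: "\<sigma> = 1 \<and> S < 0 \<or> \<sigma> = -1 \<and> S > 0"
    using \<sigma> unfolding S_def power2_eq_1_iff by auto
  have "(P * z - S)\<^sup>2 = D \<and> z * (b \<bullet> (z *\<^sub>R p - c)) < 0 \<longleftrightarrow> P * z - S = \<sigma> * sqrt D"
  proof (cases "(P * z - S)\<^sup>2 = D")
    case True
    then have "\<bar>P * z - S\<bar> = sqrt D" by (metis real_sqrt_abs)
    then have u: "P * z - S = sqrt D \<or> P * z - S = - sqrt D" by linarith
    have "z * S > 0"
    proof -
      have "S > 0 \<and> P * z > 0 \<or> S < 0 \<and> P * z < 0" using u sDS sD(2) by linarith
      then have "P * z * S > 0" by (auto intro: mult_neg_neg)
      then show ?thesis using P by (simp add: zero_less_mult_iff mult.assoc)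
    qed
    then show ?thesis
      using sgn[OF True] u sig sD(2) True
      by (auto simp: zero_less_mult_iff mult_less_0_iff)
  next
    case False
    then have "P * z - S \<noteq> \<sigma> * sqrt D" using \<sigma>(1) sD(1) by (auto simp: power_mult_distrib)
    with False show ?thesis by simp
  qed
  also have "\<dots> \<longleftrightarrow> z = (S + \<sigma> * sqrt D) / P" using P by (auto simp: field_simps)
  finally show "norm (z *\<^sub>R p - c) ^ 2 = r\<^sup>2 \<and> z * (b \<bullet> (z *\<^sub>R p - c)) < 0 \<longleftrightarrow>
      z = (p \<bullet> c + \<sigma> * sqrt D) / (p \<bullet> p)"
    unfolding circ S_def P_def .
qed

text \<open>The quadratic \<open>2 T1 s\<^sup>2 + 2 T s - a r\<^sup>2\<close>, whose larger root in absolute value is the left-hand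
  fraction of \<open>large\<close>, is the strict barrier condition at \<open>x\<^sub>c + s perp B\<close>, where the control has
  no effect on \<open>h\<close>. At \<open>\<bar>s\<bar> = r / \<bar>B\<bar>\<close> (on the circle) the \<open>a\<close>-terms cancel.\<close>

lemma strict_cbf_radius:
  fixes r Q T a N :: real
  defines "T1 \<equiv> Q + 1/2 * a * N"
  assumes r: "r > 0" and a: "a > 0" and N: "N > 0" and T1: "T1 > 0"
    and large: "r / sqrt N > (\<bar>T\<bar> + sqrt (T\<^sup>2 + 2 * a * r\<^sup>2 * T1)) / (2 * T1)"
  shows "Q > 0" and "T\<^sup>2 * N < (r * Q)\<^sup>2"
proof -
  define \<rho> where "\<rho> = r / sqrt N"
  have \<rho>: "\<rho> > 0" "\<rho>\<^sup>2 * N = r\<^sup>2" using r N by (simp_all add: \<rho>_def power_divide)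
  have "sqrt (T\<^sup>2 + 2 * a * r\<^sup>2 * T1) < 2 * T1 * \<rho> - \<bar>T\<bar>"
    using large T1 by (simp add: \<rho>_def[symmetric] field_simps)
  moreover have "T\<^sup>2 + 2 * a * r\<^sup>2 * T1 \<ge> 0" using a T1 by simp
  ultimately have "T\<^sup>2 + 2 * a * r\<^sup>2 * T1 < (2 * T1 * \<rho> - \<bar>T\<bar>)\<^sup>2"
    by (metis real_sqrt_ge_zero real_sqrt_pow2 power_strict_mono pos2)
  also have "\<dots> = 4 * T1\<^sup>2 * \<rho>\<^sup>2 - 4 * T1 * \<rho> * \<bar>T\<bar> + T\<^sup>2"
    by (simp add: power2_diff power_mult_distrib)
  finally have "2 * T1 * (a * r\<^sup>2) < 2 * T1 * (2 * T1 * \<rho>\<^sup>2 - 2 * \<rho> * \<bar>T\<bar>)"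
    by (simp add: algebra_simps power2_eq_square)
  then have "a * r\<^sup>2 < 2 * T1 * \<rho>\<^sup>2 - 2 * \<rho> * \<bar>T\<bar>" using T1 by simp
  also have "\<dots> = 2 * \<rho> * (\<rho> * Q - \<bar>T\<bar>) + a * r\<^sup>2"
    unfolding T1_def \<rho>(2)[symmetric] by (simp add: algebra_simps power2_eq_square)
  finally have lt: "\<bar>T\<bar> < \<rho> * Q" using \<rho>(1) by (simp add: zero_less_mult_iff)
  then have "0 < \<rho> * Q" by linarith
  then show "Q > 0" using \<rho>(1) by (simp add: zero_less_mult_iff)
  have "T\<^sup>2 < (\<rho> * Q)\<^sup>2" using lt by (metis abs_ge_zero power2_abs power_strict_mono pos2)
  then have "T\<^sup>2 * N < (\<rho> * Q)\<^sup>2 * N" using N by simp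
  also have "\<dots> = (r * Q)\<^sup>2" by (simp add: power_mult_distrib flip: \<rho>(2))
  finally show "T\<^sup>2 * N < (r * Q)\<^sup>2" .
qed

section \<open>Undesired equilibria on the line spanned by \<open>p\<close>\<close>

text \<open>The adjugate of a plane matrix is linear in the matrix, and that of the product of
  \<open>B\<close> and \<open>K\<close> annihilates \<open>B\<close>; hence \<open>p\<close>
  involves \<open>A\<close> and \<open>B\<close> only. The second identity compares the determinants
  of \<open>(M x, B)\<close> and \<open>(x, p)\<close>.\<close>

lemma nominal_matrix_adjugate:
  fixes A :: "real^2^2" and B K :: "real^2"
  defines "p \<equiv> vector [A$2$2 * B$1 - A$1$2 * B$2, A$1$1 * B$2 - A$2$1 * B$1]"
  shows "nominal_matrix A B K *v p = det (nominal_matrix A B K) *\<^sub>R B"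
    and "(nominal_matrix A B K *v x) \<bullet> perp B = x \<bullet> perp p"
proof -
  have M: "nominal_matrix A B K $ i $ j = A $ i $ j - B $ i * K $ j" for i j
    by (simp add: nominal_matrix_def matrix_matrix_mult_def columnvector_def rowvector_def)
  show "nominal_matrix A B K *v p = det (nominal_matrix A B K) *\<^sub>R B"
    by (simp add: vec_eq_iff forall_2 matrix_vector_mult_def sum_2 det_2 M p_def algebra_simps)
  show "(nominal_matrix A B K *v x) \<bullet> perp B = x \<bullet> perp p"
    by (simp add: inner_perp matrix_vector_mult_def sum_2 M p_def algebra_simps)
qed

text \<open>The drift is parallel to \<open>B\<close> exactly on the line of \<open>p\<close>, where
  it is \<open>(z * d) *\<^sub>R B\<close>. Since \<open>d\<close> and \<open>G x\<close> are
  positive, the sign of \<delta> becomes that of \<open>z * (B \<bullet> grad h x)\<close>.\<close>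

lemma undesired_equilibrium_iff:
  fixes B p :: "real^2"
  assumes G_pos: "\<And>x. G x > 0" and "B \<noteq> 0" and "d > 0"
    and Mp: "nominal_matrix A B K *v p = d *\<^sub>R B"
    and perp: "\<And>x. (nominal_matrix A B K *v x) \<bullet> perp B = x \<bullet> perp p"
    and "h 0 \<noteq> 0"
  shows "x \<in> undesired_equilibria A B K G h \<longleftrightarrow>
    (\<exists>z. x = z *\<^sub>R p \<and> h x = 0 \<and> z * (B \<bullet> grad h x) < 0)"
proof
  assume "x \<in> undesired_equilibria A B K G h"
  then obtain \<delta> where x: "h x = 0" "\<delta> < 0"
    "nominal_matrix A B K *v x = (\<delta> * inverse (G x) * (B \<bullet> grad h x)) *\<^sub>R B"
    unfolding undesired_equilibria_def by blast
  have "p \<noteq> 0" using Mp \<open>B \<noteq> 0\<close> \<open>d > 0\<close> by auto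
  moreover have "x \<bullet> perp p = 0" using perp[of x] by (simp add: x(3))
  ultimately obtain z where z: "x = z *\<^sub>R p" using parallel_if_inner_perp_zero by blast
  then have "z * d = \<delta> * inverse (G x) * (B \<bullet> grad h x)"
    using x(3) Mp \<open>B \<noteq> 0\<close> by (simp add: matrix_vector_mult_scaleR)
  \<comment> \<open>The factor \<open>z\<close> makes the left-hand side positive, so the two
    factors on the right share their sign.\<close>
  then have eq: "d * z\<^sup>2 = (\<delta> * inverse (G x)) * (z * (B \<bullet> grad h x))"
    by (simp add: power2_eq_square algebra_simps)
  have "z \<noteq> 0" using z x(1) \<open>h 0 \<noteq> 0\<close> by auto
  then have "d * z\<^sup>2 > 0" using \<open>d > 0\<close> by simp
  moreover have "\<delta> * inverse (G x) < 0" using x(2) G_pos[of x] by (simp add: mult_neg_pos)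
  ultimately have "z * (B \<bullet> grad h x) < 0"
    unfolding eq zero_less_mult_iff[of "\<delta> * inverse (G x)"] by linarith
  with z x(1) show "\<exists>z. x = z *\<^sub>R p \<and> h x = 0 \<and> z * (B \<bullet> grad h x) < 0" by blast
next
  assume "\<exists>z. x = z *\<^sub>R p \<and> h x = 0 \<and> z * (B \<bullet> grad h x) < 0"
  then obtain z where z: "x = z *\<^sub>R p" "h x = 0" "z * (B \<bullet> grad h x) < 0" by blast
  let ?y = "B \<bullet> grad h x"
  have "?y \<noteq> 0" using z(3) by auto
  then have "nominal_matrix A B K *v x = (z * d * G x / ?y * inverse (G x) * ?y) *\<^sub>R B"
    using z(1) Mp G_pos[of x] by (simp add: matrix_vector_mult_scaleR)
  moreover have "z / ?y < 0"
    using z(3) by (auto simp: mult_less_0_iff divide_less_0_iff)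
  then have "(z / ?y) * (d * G x) < 0"
    using \<open>d > 0\<close> G_pos[of x] by (intro mult_neg_pos mult_pos_pos)
  then have "z * d * G x / ?y < 0" by (simp add: mult_ac)
  ultimately show "x \<in> undesired_equilibria A B K G h"
    unfolding undesired_equilibria_def using z(2) by blast
qed

section \<open>The Jacobian at an undesired equilibrium\<close>

lemma saddle_point_undesired:
  fixes B c p :: "real^2" and r a :: real
  defines "h \<equiv> \<lambda>x. (norm (x - c))\<^sup>2 - r\<^sup>2" and "\<alpha> \<equiv> \<lambda>s. a * s"
  assumes G_pos: "\<And>x. G x > 0" and "a > 0"
    and perp: "\<And>x. (nominal_matrix A B K *v x) \<bullet> perp B = x \<bullet> perp p"
    and x: "x \<in> undesired_equilibria A B K G h" "nominal_matrix A B K *v x \<noteq> 0"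
    and pos: "(B \<bullet> (x - c)) * (p \<bullet> (x - c)) > 0"
  shows "saddle_point (filtered_system A B K G \<alpha> h) x"
proof -
  let ?F = "filtered_system A B K G \<alpha> h" and ?M = "nominal_matrix A B K"
  have h': "GDERIV h z :> 2 *\<^sub>R (z - c)" for z
    unfolding h_def by (rule GDERIV_norm_diff_sq)
  then have grad_h: "grad h z = 2 *\<^sub>R (z - c)" for z by (rule grad_eqI)
  define E where "E = safety_margin A B K \<alpha> h"
  have E: "E z = (2 *\<^sub>R (z - c)) \<bullet> (?M *v z) + a * ((norm (z - c))\<^sup>2 - r\<^sup>2)" for z
    unfolding E_def safety_margin_def grad_h by (simp add: \<alpha>_def h_def)
  have active: "B \<bullet> grad h x \<noteq> 0" "E x < 0" "?F x = 0"
    using undesired_equilibrium_active[where G = G and \<alpha> = \<alpha>, OF G_pos x]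
    by (simp_all add: E_def \<alpha>_def)
  \<comment> \<open>On this neighbourhood of \<open>x\<close> the case distinction of the filter
    disappears and the closed loop is a single smooth expression.\<close>
  define U where "U = {z. E z < 0} \<inter> {z. B \<bullet> grad h z \<noteq> 0}"
  have "open U"
    unfolding U_def E grad_h
    by (intro open_Int open_Collect_less open_Collect_neq continuous_intros
        linear_continuous_on matrix_vector_mul_bounded_linear)
  have "x \<in> U" using active by (simp add: U_def)
  have F_eq: "?M *v z - (E z / (B \<bullet> grad h z)) *\<^sub>R B = ?F z" if "z \<in> U" for z
    using that filtered_system_active[where G = G and \<alpha> = \<alpha>, OF G_pos]
    by (simp add: U_def E_def)
  have dM: "(\<lambda>z. ?M *v z) differentiable (at x)"
    by (intro linear_imp_differentiable matrix_vector_mul_linear)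
  have "(\<lambda>z. ?M *v z - (E z / (B \<bullet> grad h z)) *\<^sub>R B) differentiable (at x)"
  proof -
    have dh: "h differentiable (at x)"
      using h' unfolding gderiv_def differentiable_def by blast
    have "E = (\<lambda>z. (2 *\<^sub>R (z - c)) \<bullet> (?M *v z) + a * h z)"
      by (simp add: fun_eq_iff E h_def)
    moreover have "(\<lambda>z. (2 *\<^sub>R (z - c)) \<bullet> (?M *v z) + a * h z) differentiable (at x)"
      by (intro differentiable_add differentiable_inner differentiable_mult derivative_intros dM dh)
    ultimately have "E differentiable (at x)" by simp
    moreover have "(\<lambda>z. B \<bullet> grad h z) differentiable (at x)"
      unfolding grad_h by (intro differentiable_inner derivative_intros)
    ultimately show ?thesis
      using active(1) by (intro derivative_intros dM)
  qed
  then obtain D where "((\<lambda>z. ?M *v z - (E z / (B \<bullet> grad h z)) *\<^sub>R B) has_derivative D) (at x)"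
    unfolding differentiable_def by blast
  then have "(?F has_derivative D) (at x)"
    by (rule has_derivative_transform_within_open[OF _ \<open>open U\<close> \<open>x \<in> U\<close> F_eq])
  then have diff: "?F differentiable (at x)" unfolding differentiable_def by blast
  then have J: "(?F has_derivative (\<lambda>w. jacobian ?F (at x) *v w)) (at x)"
    by (simp add: jacobian_works)
  show ?thesis
  proof (rule saddle_pointI[OF active(3) diff \<open>a > 0\<close> _ _ pos])
    fix w
    \<comment> \<open>Product rule; the second term vanishes because \<open>x\<close> is an
      equilibrium.\<close>
    have "((\<lambda>z. (z - c) \<bullet> ?F z) has_derivative
        (\<lambda>w. (x - c) \<bullet> (jacobian ?F (at x) *v w) + (w - 0) \<bullet> ?F x)) (at x)"
      by (intro derivative_intros J)
    moreover have "(z - c) \<bullet> ?F z = - a / 2 * h z" if "z \<in> U" for z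
      using that inner_grad_filtered_system_active[where G = G and \<alpha> = \<alpha>, OF G_pos, of A B K h z]
      by (simp add: U_def E_def grad_h \<alpha>_def)
    ultimately have "((\<lambda>z. - a / 2 * h z) has_derivative
        (\<lambda>w. (x - c) \<bullet> (jacobian ?F (at x) *v w) + (w - 0) \<bullet> ?F x)) (at x)"
      by (rule has_derivative_transform_within_open[OF _ \<open>open U\<close> \<open>x \<in> U\<close>])
    then have "((\<lambda>z. - a / 2 * h z) has_derivative
        (\<lambda>w. (x - c) \<bullet> (jacobian ?F (at x) *v w))) (at x)"
      unfolding active(3) by simp
    moreover have "((\<lambda>z. - a / 2 * h z) has_derivative (\<lambda>w. - a / 2 * (w \<bullet> (2 *\<^sub>R (x - c))))) (at x)"
      using h' unfolding gderiv_def by (intro derivative_intros)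
    ultimately have "(\<lambda>w. (x - c) \<bullet> (jacobian ?F (at x) *v w)) =
        (\<lambda>w. - a / 2 * (w \<bullet> (2 *\<^sub>R (x - c))))"
      by (rule has_derivative_unique)
    from fun_cong[OF this, of w]
    show "(x - c) \<bullet> (jacobian ?F (at x) *v w) = - a * ((x - c) \<bullet> w)"
      by (simp add: inner_commute)
    \<comment> \<open>This identity needs no neighbourhood: \<open>perp B\<close> annihilates the
      control term everywhere.\<close>
    have "((\<lambda>z. ?F z \<bullet> perp B) has_derivative
        (\<lambda>w. (jacobian ?F (at x) *v w) \<bullet> perp B)) (at x)"
      by (intro derivative_intros has_derivative_inner_left J)
    moreover have "(\<lambda>z. ?F z \<bullet> perp B) = (\<lambda>z. z \<bullet> perp p)"
      by (simp add: filtered_system_def inner_add_left perp)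
    moreover have "((\<lambda>z. z \<bullet> perp p) has_derivative (\<lambda>w. w \<bullet> perp p)) (at x)"
      by (intro has_derivative_inner_left has_derivative_ident)
    ultimately have "(\<lambda>w. (jacobian ?F (at x) *v w) \<bullet> perp B) = (\<lambda>w. w \<bullet> perp p)"
      using has_derivative_unique by metis
    then show "(jacobian ?F (at x) *v w) \<bullet> perp B = w \<bullet> perp p" by (rule fun_cong)
  qed
qed

section \<open>Classification of the undesired equilibria\<close>

theorem proposition5p9:
  fixes a11 a12 a21 a22 b1 b2 k1 k2 r \<alpha>0 xc1 xc2 \<beta> \<gamma> T1 T2 T3 zp zm :: real
    and A :: "real^2^2" and B K x_c xp xm :: "real^2"
    and h G :: "real^2 \<Rightarrow> real" and \<alpha> :: "real \<Rightarrow> real"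
    and F :: "real^2 \<Rightarrow> real^2"
  assumes A: "A = vector [vector [a11, a12], vector [a21, a22]]"
    and B: "B = vector [b1, b2]"
    and K: "K = vector [k1, k2]"
    and hurwitz: "Hurwitz (nominal_matrix A B K)"
    and x_c: "x_c = vector [xc1, xc2]"
    and r: "r > 0"
    and h: "h = (\<lambda>x. (norm (x - x_c))\<^sup>2 - r\<^sup>2)"
    and h0: "h 0 > 0"
    and G_C1: "continuously_differentiable G"
    and G_pos: "\<And>x. G x > 0"
    and \<beta>: "\<beta> = a11 * b2 - b1 * a21"
    and \<gamma>: "\<gamma> = a22 * b1 - b2 * a12"
    and T3: "T3 = - \<gamma> * xc2 + \<beta> * xc1"
    and \<alpha>0: "\<alpha>0 > 0"
    and \<alpha>: "\<alpha> = (\<lambda>s. \<alpha>0 * s)"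
    and T1: "T1 = b2 * \<beta> + b1 * \<gamma> + 1/2 * \<alpha>0 * (b2\<^sup>2 + b1\<^sup>2)"
    and T2: "T2 = (\<beta> * xc1 - \<gamma> * xc2)\<^sup>2 + 2 * \<alpha>0 * r\<^sup>2 * T1"
    and b_pos: "b1\<^sup>2 + b2\<^sup>2 > 0"
    and T1_pos: "T1 > 0"
    and r_large: "r / sqrt (b2\<^sup>2 + b1\<^sup>2) > (\<bar>T3\<bar> + sqrt T2) / (2 * T1)"
    and zp: "zp = (\<gamma> * xc1 + \<beta> * xc2 + sqrt (r\<^sup>2 * (\<gamma>\<^sup>2 + \<beta>\<^sup>2) - T3\<^sup>2)) / (\<gamma>\<^sup>2 + \<beta>\<^sup>2)"
    and zm: "zm = (\<gamma> * xc1 + \<beta> * xc2 - sqrt (r\<^sup>2 * (\<gamma>\<^sup>2 + \<beta>\<^sup>2) - T3\<^sup>2)) / (\<gamma>\<^sup>2 + \<beta>\<^sup>2)"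
    and xp: "xp = vector [\<gamma> * zp, \<beta> * zp]"
    and xm: "xm = vector [\<gamma> * zm, \<beta> * zm]"
    and F: "F = filtered_system A B K G \<alpha> h"
  shows "\<gamma> * xc1 + \<beta> * xc2 \<noteq> 0 \<and>
    (\<gamma> * xc1 + \<beta> * xc2 < 0 \<longrightarrow>
       undesired_equilibria A B K G h = {xp} \<and>
       {x \<in> safe_set h. equilibrium F x \<and> x \<noteq> 0} = {xp} \<and>
       saddle_point F xp) \<and>
    (\<gamma> * xc1 + \<beta> * xc2 > 0 \<longrightarrow>
       undesired_equilibria A B K G h = {xm} \<and>
       {x \<in> safe_set h. equilibrium F x \<and> x \<noteq> 0} = {xm} \<and>
       saddle_point F xm)"
proof -
  let ?M = "nominal_matrix A B K"
  define p :: "real^2" where "p = vector [\<gamma>, \<beta>]"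
  define S D where "S = \<gamma> * xc1 + \<beta> * xc2" and "D = r\<^sup>2 * (\<gamma>\<^sup>2 + \<beta>\<^sup>2) - T3\<^sup>2"
  have entries: "A$1$1 = a11" "A$1$2 = a12" "A$2$1 = a21" "A$2$2 = a22"
    "B$1 = b1" "B$2 = b2" "x_c$1 = xc1" "x_c$2 = xc2" "p$1 = \<gamma>" "p$2 = \<beta>"
    by (simp_all add: A B x_c p_def)
  have detM: "det ?M > 0" using hurwitz by (rule Hurwitz_2_det_pos)
  have p_adj: "p = vector [A$2$2 * B$1 - A$1$2 * B$2, A$1$1 * B$2 - A$2$1 * B$1]"
    unfolding p_def entries \<beta> \<gamma> by (simp add: mult.commute)
  have Mp: "?M *v p = det ?M *\<^sub>R B" and perp: "(?M *v x) \<bullet> perp B = x \<bullet> perp p" for x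
    unfolding p_adj by (rule nominal_matrix_adjugate)+
  have inner: "p \<bullet> p = \<gamma>\<^sup>2 + \<beta>\<^sup>2" "B \<bullet> B = b2\<^sup>2 + b1\<^sup>2" "p \<bullet> x_c = S"
    "p \<bullet> B = b2 * \<beta> + b1 * \<gamma>"
    by (simp_all add: inner_2 entries S_def power2_eq_square)
  have cross: "x_c \<bullet> perp p = T3" by (simp add: inner_perp entries T3)
  have "B \<noteq> 0" using b_pos unfolding B by (auto simp: vec_eq_iff forall_2)
  have inj: "x = 0" if "?M *v x = 0" for x
    using that detM by (metis invertible_det_nz invertible_left_inverse less_irrefl matrix_left_invertible_ker)
  have T2_eq: "T2 = T3\<^sup>2 + 2 * \<alpha>0 * r\<^sup>2 * T1" by (simp add: T2 T3 algebra_simps)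
  have outside: "x_c \<bullet> x_c > r\<^sup>2" using h0 by (simp add: h power2_norm_eq_inner)
  have "b2\<^sup>2 + b1\<^sup>2 > 0" using b_pos by simp
  \<comment> \<open>Here \<open>p \<bullet> B\<close> and \<open>B \<bullet> B\<close> take the
    places of \<open>Q\<close> and \<open>N\<close>, so the radicand in the lemma is
    \<open>T2\<close>.\<close>
  from strict_cbf_radius[OF r \<alpha>0 this, of "b2 * \<beta> + b1 * \<gamma>" T3] T1_pos r_large
  have "p \<bullet> B > 0" "(x_c \<bullet> perp p)\<^sup>2 * (B \<bullet> B) < (r * (p \<bullet> B))\<^sup>2"
    unfolding inner cross T2_eq T1 by simp_all
  note root = circle_line_root[OF outside this]
  have grad_h: "grad h x = 2 *\<^sub>R (x - x_c)" for x
    unfolding h by (intro grad_eqI GDERIV_norm_diff_sq)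
  have \<alpha>_iff: "\<alpha> s = 0 \<longleftrightarrow> s = 0" for s using \<alpha>0 by (simp add: \<alpha>)
  have safe: "{x \<in> safe_set h. equilibrium F x \<and> x \<noteq> 0} = undesired_equilibria A B K G h"
    unfolding F by (rule safe_equilibria_eq) (use G_pos inj \<alpha>_iff h0 in auto)
  \<comment> \<open>Both cases at once: \<sigma> is the sign before the square root, opposite to the
    sign of \<open>S\<close>.\<close>
  have main: "undesired_equilibria A B K G h = {x}" "saddle_point F x"
    if \<sigma>: "\<sigma>\<^sup>2 = 1" "\<sigma> * S < 0" and z0: "z0 = (S + \<sigma> * sqrt D) / (\<gamma>\<^sup>2 + \<beta>\<^sup>2)"
      and x: "x = vector [\<gamma> * z0, \<beta> * z0]" for \<sigma> z0 x
  proof -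
    have x_eq: "x = z0 *\<^sub>R p" by (simp add: x p_def vec_eq_iff forall_2)
    have iff: "(norm (z *\<^sub>R p - x_c))\<^sup>2 = r\<^sup>2 \<and> z * (B \<bullet> (z *\<^sub>R p - x_c)) < 0 \<longleftrightarrow> z = z0" for z
      using root(2)[OF \<sigma>(1)] \<sigma>(2) unfolding inner cross z0 D_def by blast
    have "y \<in> undesired_equilibria A B K G h \<longleftrightarrow> (\<exists>z. y = z *\<^sub>R p \<and> z = z0)" for y
    proof -
      have "y \<in> undesired_equilibria A B K G h \<longleftrightarrow>
          (\<exists>z. y = z *\<^sub>R p \<and> h y = 0 \<and> z * (B \<bullet> grad h y) < 0)"
        using h0 by (intro undesired_equilibrium_iff[OF G_pos \<open>B \<noteq> 0\<close> detM Mp perp]) simp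
      moreover have "h y = 0 \<and> z * (B \<bullet> grad h y) < 0 \<longleftrightarrow>
          (norm (y - x_c))\<^sup>2 = r\<^sup>2 \<and> z * (B \<bullet> (y - x_c)) < 0" for z
        unfolding grad_h by (simp add: h mult_less_0_iff)
      ultimately show ?thesis using iff by blast
    qed
    then show eq: "undesired_equilibria A B K G h = {x}" by (auto simp: x_eq)
    \<comment> \<open>The point lies on the circle and the origin does not, so the drift at
      \<open>x\<close> is nonzero by injectivity.\<close>
    have "h 0 \<noteq> 0" using h0 by simp
    moreover have "x \<in> undesired_equilibria A B K G h" by (simp add: eq)
    moreover from this have "h x = 0" by (simp add: undesired_equilibria_def)
    ultimately have mem: "x \<in> undesired_equilibria A B K G h" "?M *v x \<noteq> 0" using inj by metis+
    have "(B \<bullet> (x - x_c)) * (p \<bullet> (x - x_c)) > 0"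
      unfolding x_eq using root(3) iff by blast
    with mem show "saddle_point F x"
      unfolding F h \<alpha> by (intro saddle_point_undesired[OF G_pos \<alpha>0 perp])
  qed
  have "S \<noteq> 0" using root(1) by (simp add: inner)
  moreover have "undesired_equilibria A B K G h = {xp}" "saddle_point F xp" if "S < 0"
    using main[of 1 zp xp] that zp xp by (simp_all add: S_def D_def)
  moreover have "undesired_equilibria A B K G h = {xm}" "saddle_point F xm" if "S > 0"
    using main[of "- 1" zm xm] that zm xm by (simp_all add: S_def D_def)
  ultimately show ?thesis unfolding safe S_def by blast
qed

end
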